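(* For every integer $n\ge 5$, the generalized Petersen graph $P(n,2)$ satisfies \[ Z_{(1)}(P(n,2))=\begin{cases} 5 & \text{if } n=5 \text{ or } n=8,\\ 6 & \text{if } n=6, \ n=7, \text{ or } n\ge 9. \end{cases} \]
   Context: All graphs are finite, simple and undirected. Let $G$ be a graph, $S\subseteq V(G)$ a set of initially blue vertices (all other vertices white), and $L\subseteq V(G)$ a set of leaks. The leaky color change rule: a blue vertex $b\notin L$ which has exactly one white neighbor $w$ may force $w$ to become blue. $S$ is an $\ell$-leaky forcing set if for every choice of a set $L$ of $\ell$ leaks, repeated application of the rule eventually turns all vertices blue. $Z_{(\ell)}(G)$ is the minimum size of an $\ell$-leaky forcing set of $G$. For $n\ge 3$ and $1\le k\le \frac{n-1}{2}$, the generalized Petersen graph $P(n,k)$ has vertex set $\{x_1,\dots,x_n,y_1,\dots,y_n\}$ and edge set $\{y_iy_{i+1}:1\le i\le n\}\cup\{x_iy_i:1\le i\le n\}\cup\{x_ix_{i+k}:1\le i\le n\}$, with indices taken modulo $n$. *)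

theory Defs
  imports Main
begin

text \<open>A graph is given by its vertex set \<open>V\<close> and its set \<open>E\<close> of edges, each edge being the
  set of its two ends.\<close>

definition simple_graph :: "'a set \<Rightarrow> 'a set set \<Rightarrow> bool" where
  "simple_graph V E \<longleftrightarrow> finite V \<and> (\<forall>e\<in>E. e \<subseteq> V \<and> card e = 2)"

definition neighbors :: "'a set \<Rightarrow> 'a set set \<Rightarrow> 'a \<Rightarrow> 'a set" where
  "neighbors V E v = {w \<in> V. {v, w} \<in> E}"

text \<open>One application of the leaky color change rule: \<open>B\<close> is the set of blue vertices, \<open>L\<close> the
  set of leaks, and a vertex of \<open>V\<close> outside \<open>B\<close> is white.\<close>

inductive leaky_step :: "'a set \<Rightarrow> 'a set set \<Rightarrow> 'a set \<Rightarrow> 'a set \<Rightarrow> 'a set \<Rightarrow> bool"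
  for V :: "'a set" and E :: "'a set set" and L :: "'a set" where
  force: "\<lbrakk>b \<in> B; b \<notin> L; neighbors V E b - B = {w}\<rbrakk> \<Longrightarrow> leaky_step V E L B (insert w B)"

definition leaky_forcing_set :: "nat \<Rightarrow> 'a set \<Rightarrow> 'a set set \<Rightarrow> 'a set \<Rightarrow> bool" where
  "leaky_forcing_set l V E S \<longleftrightarrow>
     S \<subseteq> V \<and> (\<forall>L. L \<subseteq> V \<and> card L = l \<longrightarrow> (leaky_step V E L)\<^sup>*\<^sup>* S V)"

text \<open>For finite \<open>V\<close> the minimum exists, because \<open>V\<close> itself is an \<open>l\<close>-leaky forcing set.\<close>

definition leaky_forcing_number :: "nat \<Rightarrow> 'a set \<Rightarrow> 'a set set \<Rightarrow> nat" where
  "leaky_forcing_number l V E = Min (card ` {S. leaky_forcing_set l V E S})"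

datatype pvertex = X nat | Y nat

text \<open>Indices modulo \<open>n\<close> are represented by the residues \<open>0, \<dots>, n - 1\<close>, so that index \<open>0\<close>
  plays the role of index \<open>n\<close>.\<close>

definition petersen_verts :: "nat \<Rightarrow> pvertex set" where
  "petersen_verts n = X ` {..<n} \<union> Y ` {..<n}"

definition petersen_edges :: "nat \<Rightarrow> nat \<Rightarrow> pvertex set set" where
  "petersen_edges n k =
     {{Y i, Y ((i + 1) mod n)} |i. i < n} \<union>
     {{X i, Y i} |i. i < n} \<union>
     {{X i, X ((i + k) mod n)} |i. i < n}"

lemma mod_add_neq_self:
  fixes i j n :: nat
  assumes "i < n" "0 < j" "j < n"
  shows "(i + j) mod n \<noteq> i"
  using assms by (cases "i + j < n") (auto simp: mod_if)

text \<open>The condition \<open>k \<le> (n - 1) / 2\<close> is written without division.\<close>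

lemma simple_graph_petersen:
  assumes "3 \<le> n" "1 \<le> k" "2 * k + 1 \<le> n"
  shows "simple_graph (petersen_verts n) (petersen_edges n k)"
proof -
  have "i \<noteq> (i + 1) mod n" "i \<noteq> (i + k) mod n" if "i < n" for i
    using mod_add_neq_self[of i n 1] mod_add_neq_self[of i n k] that assms by auto
  then show ?thesis
    using assms
    by (auto simp: simple_graph_def petersen_verts_def petersen_edges_def card_2_iff)
qed

lemma leaky_forcing_set_verts: "leaky_forcing_set l V E V"
  by (simp add: leaky_forcing_set_def)

lemma leaky_forcing_number_attained:
  assumes "finite V"
  shows "\<exists>S. leaky_forcing_set l V E S \<and> card S = leaky_forcing_number l V E"
proof -
  let ?C = "card ` {S. leaky_forcing_set l V E S}"
  have "{S. leaky_forcing_set l V E S} \<subseteq> Pow V"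
    by (auto simp: leaky_forcing_set_def)
  with assms have "finite ?C"
    by (meson finite_Pow_iff finite_imageI finite_subset)
  moreover have "?C \<noteq> {}"
    using leaky_forcing_set_verts by blast
  ultimately have "Min ?C \<in> ?C"
    by (rule Min_in)
  then show ?thesis
    by (auto simp: leaky_forcing_number_def)
qed

end

theory Submission imports Defs begin

text \<open>
  Leaky forcing from \<open>S\<close> stops at a set of blue vertices from which no unleaked vertex can force. Call
  such a set stalled. The process never leaves a stalled set that contains \<open>S\<close>, and it colours everything
  if the vertex set is the only stalled set containing \<open>S\<close>.

  Upper bounds. Six vertices around two neighbouring columns start one sweep to the right and one to
  the left around the graph. A single leak stops each sweep only near its own column, and the two
  sweeps meet there. For \<open>n = 5\<close> the five \<open>x\<close>-vertices force their partners, and for \<open>n = 8\<close> the 4-cycle of the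
  even \<open>x\<close>-vertices together with \<open>y 1\<close> does better than the general construction.

  Lower bounds for \<open>n \<noteq> 6\<close>. These hold even without leaks. After \<open>j\<close> forces there are \<open>|S| + j\<close> blue vertices, and
  they include the closed neighbourhoods of the \<open>j\<close> forcers (lemma \<open>forcers_within_blue\<close>). For \<open>|S| \<le> 5\<close> three
  forcers have at most eight vertices in their closed neighbourhoods. If there are no cycles of length 3 or 4,
  that is, for \<open>n\<close> other than 6 and 8, this is as few as possible, and it happens only if the forcers
  form a path or an edge with the opposite vertex of a 5-cycle. The blue set then is exactly the union of
  the closed neighbourhoods, and for \<open>n \<ge> 7\<close> it lies in a stalled set that is not the whole graph: in the closed
  neighbourhood of a 5-cycle or of a path of three \<open>x\<close>-vertices, or in the columns of one parity
  (\<open>third_trapped\<close>). The same argument with \<open>|S| \<le> 4\<close> and only two forcers handles \<open>n = 5\<close> and \<open>n = 8\<close>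
  (\<open>two_forcers_trapped\<close>).

  The lower bound for \<open>n = 6\<close>. Here four vertices can force everything if there are no leaks, so the leak has
  to be chosen against the set. If a set other than the whole vertex set is stalled for some leak, then its
  complement meets every leaky forcing set. Five rotation classes of such complements rule out all sets of
  five vertices (\<open>six_halves\<close>).
\<close>

section \<open>Stalled sets and forcers\<close>

definition stalled :: "'a set \<Rightarrow> 'a set set \<Rightarrow> 'a set \<Rightarrow> 'a set \<Rightarrow> bool" where
  "stalled V E L C \<longleftrightarrow> C \<subseteq> V \<and> (\<forall>b\<in>C - L. \<forall>w. neighbors V E b - C \<noteq> {w})"

lemma stalled_mono: "stalled V E L C \<Longrightarrow> L \<subseteq> L' \<Longrightarrow> stalled V E L' C"
  by (auto simp: stalled_def)

lemma stalled_forced: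
  assumes "stalled V E L C" "b \<in> C" "b \<notin> L" "neighbors V E b \<subseteq> insert w C" "w \<in> neighbors V E b"
  shows "w \<in> C"
proof (rule ccontr)
  assume "w \<notin> C"
  with assms(4,5) have "neighbors V E b - C = {w}" by blast
  with assms(1-3) show False unfolding stalled_def by blast
qed

lemma forcing_confined_to_stalled:
  assumes "(leaky_step V E L)\<^sup>*\<^sup>* S B" "stalled V E L C" "S \<subseteq> C"
  shows "B \<subseteq> C"
  using assms
proof (induction rule: rtranclp_induct)
  case base
  then show ?case by simp
next
  case (step A B)
  then have "A \<subseteq> C" by simp
  from step.hyps(2) obtain b w where b: "b \<in> A" "b \<notin> L" "neighbors V E b - A = {w}" "B = insert w A"
    by (auto elim: leaky_step.cases)
  have "w \<in> C"
    using step.prems(1) b \<open>A \<subseteq> C\<close> by (intro stalled_forced[of V E L C b w]) auto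
  with b \<open>A \<subseteq> C\<close> show ?case by simp
qed

lemma leaky_step_subset:
  assumes "leaky_step V E L A B" "A \<subseteq> V"
  shows "B \<subseteq> V"
proof -
  from assms(1) obtain b w where "neighbors V E b - A = {w}" "B = insert w A"
    by (auto elim: leaky_step.cases)
  with assms(2) show ?thesis by (auto simp: neighbors_def)
qed

text \<open>Together with \<open>forcing_confined_to_stalled\<close>, this reduces every question about leaky forcing to a
  question about stalled sets; no sequence of forces has to be written down.\<close>

lemma forces_all_if_no_stalled:
  assumes "finite V" "S \<subseteq> V" "\<And>C. stalled V E L C \<Longrightarrow> S \<subseteq> C \<Longrightarrow> C = V"
  shows "(leaky_step V E L)\<^sup>*\<^sup>* S V"
proof -
  let ?R = "{B. (leaky_step V E L)\<^sup>*\<^sup>* S B}"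
  have R: "B \<subseteq> V \<and> S \<subseteq> B" if "(leaky_step V E L)\<^sup>*\<^sup>* S B" for B
    using that
  proof (induction rule: rtranclp_induct)
    case base
    then show ?case using assms(2) by simp
  next
    case (step A B)
    moreover from step.hyps(2) have "A \<subseteq> B" by (auto elim: leaky_step.cases)
    ultimately show ?case using leaky_step_subset[of V E L A B] by auto
  qed
  then have "finite ?R" using assms(1) by (intro finite_subset[of ?R "Pow V"]) auto
  moreover have "S \<in> ?R" by simp
  \<comment> \<open>a maximal reachable set is stalled, since a further force would enlarge it\<close>
  ultimately obtain C where C: "C \<in> ?R" "\<And>B. B \<in> ?R \<Longrightarrow> C \<subseteq> B \<Longrightarrow> C = B"
    using finite_has_maximal[of ?R] by blast
  have "stalled V E L C"
    unfolding stalled_def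
  proof (intro conjI ballI allI notI)
    show "C \<subseteq> V" using R C(1) by simp
    fix b w assume b: "b \<in> C - L" "neighbors V E b - C = {w}"
    then have "leaky_step V E L C (insert w C)" by (intro leaky_step.force) auto
    with C(1) have "insert w C \<in> ?R" by auto
    then have "w \<in> C" using C(2) by blast
    with b show False by blast
  qed
  with R C(1) assms(3) have "C = V" by blast
  with C(1) show ?thesis by simp
qed

text \<open>The source of all lower bounds without leaks: every force adds one blue vertex and uses up one
  forcer. So a small forcing set yields \<open>j\<close> vertices with few neighbours in total, and the process is
  still to succeed from the set \<open>B\<close> around them.\<close>

lemma forcers_within_blue:
  assumes "finite V" "S \<subseteq> V" "(leaky_step V E L)\<^sup>*\<^sup>* S V" "card S + j \<le> card V"
  shows "\<exists>B I. (leaky_step V E L)\<^sup>*\<^sup>* B V \<and> B \<subseteq> V \<and> card B = card S + j \<and>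
           card I = j \<and> I \<subseteq> B \<and> (\<forall>b\<in>I. neighbors V E b \<subseteq> B)"
  using assms(4)
proof (induction j)
  case 0
  then show ?case using assms by (intro exI[of _ S] exI[of _ "{}"]) auto
next
  case (Suc j)
  then obtain B I where B: "(leaky_step V E L)\<^sup>*\<^sup>* B V" "B \<subseteq> V" "card B = card S + j"
    and I: "card I = j" "I \<subseteq> B" "\<forall>b\<in>I. neighbors V E b \<subseteq> B"
    by auto
  have "B \<noteq> V" using B(3) Suc.prems by auto
  with B(1) obtain B' where B': "leaky_step V E L B B'" "(leaky_step V E L)\<^sup>*\<^sup>* B' V"
    by (metis converse_rtranclpE)
  from B'(1) obtain b w where b: "b \<in> B" "b \<notin> L" "neighbors V E b - B = {w}" "B' = insert w B"
    by (auto elim: leaky_step.cases)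
  have "finite B" using B(2) assms(1) finite_subset by blast
  moreover from this have "finite I" using I(2) finite_subset by blast
  \<comment> \<open>an earlier forcer has no white neighbour left, so \<open>b\<close> is a new one\<close>
  moreover have "b \<notin> I" "w \<notin> B" using b I(3) by blast+
  ultimately have "card (insert b I) = Suc j" "card B' = card S + Suc j"
    using b I(1) B(3) by simp_all
  moreover have "B' \<subseteq> V" using leaky_step_subset B'(1) B(2) by blast
  moreover have "insert b I \<subseteq> B'" "\<forall>c\<in>insert b I. neighbors V E c \<subseteq> B'"
    using b I(2,3) by blast+
  ultimately show ?case using B'(2) by blast
qed

lemma leaky_forcing_number_eqI:
  assumes "finite V" "leaky_forcing_set l V E S" "card S = k"
    and "\<And>T. leaky_forcing_set l V E T \<Longrightarrow> \<not> card T < k"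
  shows "leaky_forcing_number l V E = k"
  unfolding leaky_forcing_number_def
proof (rule Min_eqI)
  have "{T. leaky_forcing_set l V E T} \<subseteq> Pow V"
    by (auto simp: leaky_forcing_set_def)
  then show "finite (card ` {T. leaky_forcing_set l V E T})"
    using assms(1) by (meson finite_Pow_iff finite_imageI finite_subset)
  show "k \<in> card ` {T. leaky_forcing_set l V E T}"
    using assms(2,3) by blast
  show "k \<le> m" if "m \<in> card ` {T. leaky_forcing_set l V E T}" for m
    using assms(4) that by force
qed

section \<open>Integer coordinates on P(n, 2)\<close>

locale petersen2 =
  fixes n :: nat
  assumes n_ge: "5 \<le> n"
begin

abbreviation V where "V \<equiv> petersen_verts n"

abbreviation E where "E \<equiv> petersen_edges n 2"

abbreviation N where "N v \<equiv> neighbors V E v"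

text \<open>Letting the indices run over all integers makes the rotations and reflections of the graph plain
  arithmetic on indices; equality of vertices becomes divisibility of index differences by \<open>n\<close>.\<close>

definition x :: "int \<Rightarrow> pvertex" where "x j = X (nat (j mod int n))"

definition y :: "int \<Rightarrow> pvertex" where "y j = Y (nat (j mod int n))"

lemma finite_V: "finite V"
  by (simp add: petersen_verts_def)

lemma card_V: "card V = 2 * n"
proof -
  have "card V = card (X ` {..<n}) + card (Y ` {..<n})"
    unfolding petersen_verts_def by (rule card_Un_disjoint) auto
  then show ?thesis by (simp add: card_image inj_on_def)
qed

lemma finite_N [simp]: "finite (N v)"
  using finite_V by (auto simp: neighbors_def)

lemma mod_index: "nat (j mod int n) = nat (k mod int n) \<longleftrightarrow> int n dvd (j - k)"
  using n_ge by (simp add: mod_eq_dvd_iff nat_eq_iff)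

lemma xy_eq [simp]:
  "x j = x k \<longleftrightarrow> int n dvd (j - k)" "y j = y k \<longleftrightarrow> int n dvd (j - k)"
  "x j \<noteq> y k" "y j \<noteq> x k"
  by (auto simp: x_def y_def mod_index)

lemma xy_in_V [simp]: "x j \<in> V" "y j \<in> V"
  using n_ge by (auto simp: x_def y_def petersen_verts_def nat_less_iff)

lemma V_cases:
  assumes "v \<in> V"
  obtains (x) j where "v = x j" "0 \<le> j" "j < int n" | (y) j where "v = y j" "0 \<le> j" "j < int n"
proof -
  from assms consider i where "v = X i" "i < n" | i where "v = Y i" "i < n"
    by (auto simp: petersen_verts_def)
  then show thesis
    using that(1)[of "int i" for i] that(2)[of "int i" for i]
    by cases (auto simp: x_def y_def)
qed

lemma X_edge_iff:
  assumes "i < n"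
  shows "{X i, w} \<in> E \<longleftrightarrow> w = Y i \<or> w = X ((i + 2) mod n) \<or> (\<exists>a<n. i = (a + 2) mod n \<and> w = X a)"
  using assms unfolding petersen_edges_def
  by (auto simp: doubleton_eq_iff)

lemma Y_edge_iff:
  assumes "i < n"
  shows "{Y i, w} \<in> E \<longleftrightarrow> w = X i \<or> w = Y ((i + 1) mod n) \<or> (\<exists>a<n. i = (a + 1) mod n \<and> w = Y a)"
  using assms unfolding petersen_edges_def
  by (auto simp: doubleton_eq_iff)

lemma pred_index:
  assumes "d < n"
  shows "(a < n \<and> nat (j mod int n) = (a + d) mod n) \<longleftrightarrow> a = nat ((j - int d) mod int n)"
proof -
  have *: "nat (j mod int n) = (a + d) mod n \<longleftrightarrow> int n dvd (j - (int a + int d))"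
    using mod_index[of j "int a + int d"] by (simp add: nat_mod_as_int)
  have "a = nat ((j - int d) mod int n) \<longleftrightarrow> int n dvd (j - int d - int a)" if "a < n"
    using mod_index[of "j - int d" "int a"] that by auto
  moreover have "nat ((j - int d) mod int n) < n" using n_ge by (simp add: nat_less_iff)
  ultimately show ?thesis using * by (auto simp: algebra_simps)
qed

lemma succ_index: "(nat (j mod int n) + d) mod n = nat ((j + int d) mod int n)"
  using n_ge by (simp add: nat_mod_as_int mod_add_left_eq)

lemma N_x: "N (x j) = {y j, x (j + 2), x (j - 2)}"
proof -
  let ?i = "nat (j mod int n)"
  have i: "?i < n" using n_ge by (simp add: nat_less_iff)
  have succ: "X ((?i + 2) mod n) = x (j + 2)"
    using succ_index[of j 2] by (simp add: x_def)
  have pred: "(\<exists>a<n. ?i = (a + 2) mod n \<and> w = X a) \<longleftrightarrow> w = x (j - 2)" for w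
    using pred_index[of 2 _ j] n_ge by (auto simp: x_def)
  have "{x j, w} \<in> E \<longleftrightarrow> w = y j \<or> w = x (j + 2) \<or> w = x (j - 2)" for w
    using X_edge_iff[OF i, of w] unfolding pred succ by (simp add: x_def y_def)
  then show ?thesis by (auto simp: neighbors_def)
qed

lemma N_y: "N (y j) = {x j, y (j + 1), y (j - 1)}"
proof -
  let ?i = "nat (j mod int n)"
  have i: "?i < n" using n_ge by (simp add: nat_less_iff)
  have succ: "Y ((?i + 1) mod n) = y (j + 1)"
    using succ_index[of j 1] by (simp add: y_def)
  have pred: "(\<exists>a<n. ?i = (a + 1) mod n \<and> w = Y a) \<longleftrightarrow> w = y (j - 1)" for w
    using pred_index[of 1 _ j] n_ge by (auto simp: y_def)
  have "{y j, w} \<in> E \<longleftrightarrow> w = x j \<or> w = y (j + 1) \<or> w = y (j - 1)" for w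
    using Y_edge_iff[OF i, of w] unfolding pred succ by (simp add: x_def y_def)
  then show ?thesis by (auto simp: neighbors_def)
qed

lemma edge_cases:
  assumes "u \<in> V" "v \<in> N u"
  obtains (xx) j where "{u, v} = {x j, x (j + 2)}" | (xy) j where "{u, v} = {x j, y j}"
    | (yy) j where "{u, v} = {y j, y (j + 1)}"
proof -
  have *: thesis if "u = x j" "v = x (j - 2)" for j
    using that xx[of "j - 2"] by (simp add: insert_commute del: xy_eq)
  have **: thesis if "u = y j" "v = y (j - 1)" for j
    using that yy[of "j - 1"] by (simp add: insert_commute del: xy_eq)
  from assms(1) show thesis
  proof (cases rule: V_cases)
    case (x j)
    with assms(2) have "v = y j \<or> v = x (j + 2) \<or> v = x (j - 2)" by (simp add: N_x)
    with x(1) * xx[of j] xy[of j] show thesis by blast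
  next
    case (y j)
    with assms(2) have "v = x j \<or> v = y (j + 1) \<or> v = y (j - 1)" by (simp add: N_y)
    with y(1) ** yy[of j] xy[of j] show thesis by blast
  qed
qed

text \<open>Two vertices with explicit indices are told apart by showing that \<open>n\<close> does not divide the difference
  of the indices. The next facts decide this for the differences that occur.\<close>

lemma not_dvd_small:
  assumes "0 < \<bar>d\<bar>" "\<bar>d\<bar> < int n" shows "\<not> int n dvd d"
  using assms dvd_imp_le_int[of d "int n"] by auto

lemma dvd_below_double:
  assumes "int n dvd d" "0 < d" "d < 2 * int n"
  shows "d = int n"
proof -
  from assms(1) obtain k where k: "d = int n * k" by (elim dvdE)
  with assms n_ge have "0 < k" "k < 2" by (simp_all add: zero_less_mult_iff mult.commute)
  then have "k = 1" by simp
  with k show ?thesis by simp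
qed

lemma not_dvd_upto_4:
  "\<not> int n dvd 1" "\<not> int n dvd 2" "\<not> int n dvd 3" "\<not> int n dvd 4"
  using n_ge not_dvd_small[of 1] not_dvd_small[of 2] not_dvd_small[of 3] not_dvd_small[of 4] by auto

lemma not_dvd_upto_6_or_8:
  assumes "7 \<le> n" 
  shows "\<not> int n dvd 1" "\<not> int n dvd 2" "\<not> int n dvd 3" "\<not> int n dvd 4" "\<not> int n dvd 5" "\<not> int n dvd 6"
    "n \<noteq> 8 \<Longrightarrow> \<not> int n dvd 8"
proof -
  show "\<not> int n dvd 8" if "n \<noteq> 8"
    using dvd_below_double[of 8] assms that by auto
qed (use assms not_dvd_small[of 1] not_dvd_small[of 2] not_dvd_small[of 3] not_dvd_small[of 4]
      not_dvd_small[of 5] not_dvd_small[of 6] in auto)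

lemma dvd_7_8_10:
  assumes "7 \<le> n"
  shows "int n dvd 7 \<longleftrightarrow> n = 7" "int n dvd 8 \<longleftrightarrow> n = 8" "int n dvd 10 \<longleftrightarrow> n = 10"
  using dvd_below_double[of 7] dvd_below_double[of 8] dvd_below_double[of 10] assms by auto

section \<open>Leaky forcing sets of five and six vertices\<close>

lemma leaky_forcing_setI:
  assumes "S \<subseteq> V" "\<And>l C. l \<in> V \<Longrightarrow> stalled V E {l} C \<Longrightarrow> S \<subseteq> C \<Longrightarrow> V \<subseteq> C"
  shows "leaky_forcing_set 1 V E S"
  unfolding leaky_forcing_set_def
proof (intro conjI allI impI)
  fix L assume "L \<subseteq> V \<and> card L = 1"
  then obtain l where "L = {l}" "l \<in> V" by (auto simp: card_1_singleton_iff)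
  then show "(leaky_step V E L)\<^sup>*\<^sup>* S V"
    using assms by (intro forces_all_if_no_stalled finite_V) (auto simp: stalled_def)
qed (use assms in simp)

lemma stalled_x:
  assumes "stalled V E L C" "x j \<in> C" "x j \<notin> L"
  shows "x (j + 2) \<in> C \<Longrightarrow> x (j - 2) \<in> C \<Longrightarrow> y j \<in> C"
    and "y j \<in> C \<Longrightarrow> x (j - 2) \<in> C \<Longrightarrow> x (j + 2) \<in> C"
    and "y j \<in> C \<Longrightarrow> x (j + 2) \<in> C \<Longrightarrow> x (j - 2) \<in> C"
  by (rule stalled_forced[OF assms]; simp add: N_x)+

lemma stalled_y:
  assumes "stalled V E L C" "y j \<in> C" "y j \<notin> L"
  shows "y (j + 1) \<in> C \<Longrightarrow> y (j - 1) \<in> C \<Longrightarrow> x j \<in> C"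
    and "x j \<in> C \<Longrightarrow> y (j - 1) \<in> C \<Longrightarrow> y (j + 1) \<in> C"
    and "x j \<in> C \<Longrightarrow> y (j + 1) \<in> C \<Longrightarrow> y (j - 1) \<in> C"
  by (rule stalled_forced[OF assms]; simp add: N_y)+

text \<open>If the columns from \<open>2\<close> to \<open>m - 1\<close> contain no leak, then blue spreads to column \<open>m\<close>: the last \<open>g\<close>
  forces the next \<open>g\<close>, and the last \<open>f\<close> but one forces the \<open>f\<close> two steps on. The vertices are given by
  functions \<open>f\<close> and \<open>g\<close>, so that the lemma applies in both directions around the graph.\<close>

lemma sweep:
  fixes f g :: "int \<Rightarrow> pvertex" and m :: int
  assumes N: "\<And>j. N (f j) = {g j, f (j + 2), f (j - 2)}" "\<And>j. N (g j) = {f j, g (j + 1), g (j - 1)}"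
    and C: "stalled V E L C" "{f 0, f 1, f 2, f 3, g 1, g 2} \<subseteq> C"
    and "2 \<le> m" "\<And>i. 2 \<le> i \<Longrightarrow> i < m \<Longrightarrow> f i \<notin> L \<and> g i \<notin> L"
  shows "\<forall>i. 0 \<le> i \<and> i \<le> m \<longrightarrow> f i \<in> C \<and> (1 \<le> i \<longrightarrow> g i \<in> C)"
  using assms(5,6)
proof (induction m rule: int_ge_induct)
  case base
  have "f i \<in> C \<and> (1 \<le> i \<longrightarrow> g i \<in> C)" if "0 \<le> i" "i \<le> 2" for i
  proof -
    from that consider "i = 0" | "i = 1" | "i = 2" by linarith
    then show ?thesis using C(2) by cases auto
  qed
  then show ?case by blast
next
  case (step m)
  then have IH: "f i \<in> C" "1 \<le> i \<Longrightarrow> g i \<in> C" if "0 \<le> i" "i \<le> m" for i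
    using that by auto
  have "g (m + 1) \<in> C"
    using stalled_forced[OF C(1), of "g m" "g (m + 1)"] step.prems[of m] step.hyps IH[of m] IH[of "m - 1"]
    by (auto simp: N)
  moreover have "f (m + 1) \<in> C"
  proof (cases "m = 2")
    case True
    then show ?thesis using C(2) by simp
  next
    case False
    then show ?thesis
      using stalled_forced[OF C(1), of "f (m - 1)" "f (m + 1)"] step.prems[of "m - 1"] step.hyps
        IH[of "m - 1"] IH[of "m - 3"]
      by (auto simp: N algebra_simps)
  qed
  ultimately show ?case
    using IH by (metis zle_add1_eq_le order_le_less)
qed

text \<open>Sweeping to the right and to the left from these six vertices reaches a single leaky column from
  both sides, so together the two sweeps colour everything.\<close>

lemma six_leaky_forcing:
  defines "S \<equiv> {x 0, x 1, x 2, x 3, y 1, y 2}"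
  shows "leaky_forcing_set 1 V E S" "card S = 6"
proof -
  show "card S = 6" using not_dvd_upto_4 by (simp add: S_def)
  show "leaky_forcing_set 1 V E S"
  proof (rule leaky_forcing_setI)
    show "S \<subseteq> V" by (simp add: S_def)
    fix l C assume l: "l \<in> V" and C: "stalled V E {l} C" "S \<subseteq> C"
    \<comment> \<open>For the leaky column \<open>c\<close> between \<open>2\<close> and \<open>n + 1\<close>, the sweep to the right uses the columns from
      \<open>2\<close> to \<open>c - 1\<close> and the sweep to the left those from \<open>1\<close> down to \<open>c - n + 1\<close>.\<close>
    obtain c where c: "l = x c \<or> l = y c" "2 \<le> c" "c \<le> int n + 1"
    proof -
      from l obtain j where j: "l = x j \<or> l = y j" "0 \<le> j" "j < int n"
        by (metis V_cases)
      show thesis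
      proof (cases "2 \<le> j")
        case True
        with j that[of j] show ?thesis by auto
      next
        case False
        with j that[of "j + int n"] n_ge show ?thesis by auto
      qed
    qed
    have free: "x i \<noteq> l" "y i \<noteq> l" if "c - int n < i" "i < c" for i
      using c(1) not_dvd_small[of "i - c"] that by auto
    have right: "\<forall>i. 0 \<le> i \<and> i \<le> c \<longrightarrow> x i \<in> C \<and> (1 \<le> i \<longrightarrow> y i \<in> C)"
      using C(2) c free by (intro sweep[OF N_x N_y C(1)]) (auto simp: S_def)
    \<comment> \<open>the reflection that maps column \<open>i\<close> to column \<open>3 - i\<close> preserves the starting set\<close>
    have left: "\<forall>i. 0 \<le> i \<and> i \<le> int n + 3 - c \<longrightarrow> x (3 - i) \<in> C \<and> (1 \<le> i \<longrightarrow> y (3 - i) \<in> C)"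
      using C(2) c free n_ge
      by (intro sweep[of "\<lambda>i. x (3 - i)" "\<lambda>i. y (3 - i)", OF _ _ C(1)])
         (auto simp: S_def N_x N_y algebra_simps)
    have "x j \<in> C \<and> y j \<in> C" if j: "0 \<le> j" "j < int n" for j
    proof -
      consider "1 \<le> j" "j \<le> c" | "j = 0" "c \<le> int n" | "j = 0" "c = int n + 1" | "c < j"
        using j c(3) by linarith
      then show ?thesis
      proof cases
        case 1
        then show ?thesis using right by auto
      next
        case 2
        then show ?thesis using right left[rule_format, of 3] c by auto
      next
        case 3
        then show ?thesis using right[rule_format, of 0] right[rule_format, of "int n"] c n_ge xy_eq(2)[of 0 "int n"] 
          by (simp del: xy_eq)
      next
        case 4
        then have "x (j - int n) \<in> C" "y (j - int n) \<in> C"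
          using left[rule_format, of "3 - (j - int n)"] j by auto
        moreover have "x (j - int n) = x j" "y (j - int n) = y j" by simp_all
        ultimately show ?thesis by simp
      qed
    qed
    then show "V \<subseteq> C" by (auto elim: V_cases)
  qed
qed

lemma five_leaky_forcing_5:
  assumes n: "n = 5"
  defines "S \<equiv> {x 0, x 1, x 2, x 3, x 4}"
  shows "leaky_forcing_set 1 V E S" "card S = 5"
proof -
  show "card S = 5" using not_dvd_upto_4 by (simp add: S_def)
  show "leaky_forcing_set 1 V E S"
  proof (rule leaky_forcing_setI)
    show "S \<subseteq> V" by (simp add: S_def)
    fix l C assume l: "l \<in> V" and C: "stalled V E {l} C" "S \<subseteq> C"
    have x: "x j \<in> C" for j
    proof -
      obtain i where i: "x j = x i" "0 \<le> i" "i < 5"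
        using V_cases[OF xy_in_V(1)[of j]] n by (metis xy_eq(3) of_nat_numeral)
      then have "i = 0 \<or> i = 1 \<or> i = 2 \<or> i = 3 \<or> i = 4" by linarith
      with i(1) C(2) show ?thesis by (auto simp: S_def simp del: xy_eq)
    qed
    have y: "y j \<in> C" if "x j \<noteq> l" for j
      using stalled_x(1)[OF C(1), of j] x that by simp
    have "y j \<in> C" for j
    proof (cases "x j = l")
      case True
      then have "x (j + 1) \<noteq> l" "x (j + 2) \<noteq> l" using not_dvd_upto_4 by auto
      then show ?thesis
        using stalled_y(3)[OF C(1) y, of "j + 1"] y[of "j + 2"] x True by (auto simp: algebra_simps)
    qed (rule y)
    with x show "V \<subseteq> C" by (auto elim: V_cases)
  qed
qed

text \<open>The even \<open>x\<close>-vertices form a 4-cycle, so each, unless it is the leak, forces its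
  \<open>y\<close>-neighbour. Through the even columns the blue
  vertex \<open>y 1\<close> then spreads to all odd \<open>y\<close>-vertices, and these force the odd \<open>x\<close>-vertices.\<close>

lemma five_leaky_forcing_8:
  assumes n: "n = 8"
  defines "S \<equiv> {x 0, x 2, x 4, x 6, y 1}"
  shows "leaky_forcing_set 1 V E S" "card S = 5"
proof -
  have dvd: "\<not> int n dvd 1" "\<not> int n dvd 2" "\<not> int n dvd 3" "\<not> int n dvd 4" "\<not> int n dvd 5" "\<not> int n dvd 6"
    using not_dvd_upto_6_or_8 n by simp_all
  then show "card S = 5" by (simp add: S_def)
  have even_dvd: "even (i - k)" if "int n dvd i - k" for i k
    using that n by (metis dvd_trans even_of_nat even_numeral)
  show "leaky_forcing_set 1 V E S"
  proof (rule leaky_forcing_setI)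
    show "S \<subseteq> V" by (simp add: S_def)
    fix l C assume l: "l \<in> V" and C: "stalled V E {l} C" "S \<subseteq> C"
    note force_x = stalled_x[OF C(1)] and force_y = stalled_y[OF C(1)]
    \<comment> \<open>The indices matter modulo 8 only, so parity of an index makes sense.\<close>
    have x_even: "x k \<in> C" if "even k" for k
    proof -
      have "int n dvd k - k mod 8" using n by (simp add: minus_mod_eq_mult_div)
      then have "x k = x (k mod 8)" by simp
      moreover have "k mod 8 = 0 \<or> k mod 8 = 2 \<or> k mod 8 = 4 \<or> k mod 8 = 6"
        using that by presburger
      ultimately show ?thesis using C(2) by (auto simp: S_def simp del: xy_eq)
    qed
    have y_even: "y k \<in> C" if "even k" "x k \<noteq> l" for k
      using force_x(1)[of k] x_even that by simp
    have pass: "y (k - 1) \<in> C \<longleftrightarrow> y (k + 1) \<in> C" if "even k" "x k \<noteq> l" "y k \<noteq> l" for k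
      using force_y(2,3)[of k] x_even y_even that by auto
    \<comment> \<open>at most one even column \<open>c\<close> contains the leak, so at most one link of the ring
      \<open>y 1\<close>, \<open>y 3\<close>, \<open>y 5\<close>, \<open>y 7\<close> is broken, and the other three still join all of it\<close>
    obtain c where c: "even c" "\<And>k. even k \<Longrightarrow> \<not> int n dvd k - c \<Longrightarrow> x k \<noteq> l \<and> y k \<noteq> l"
    proof -
      obtain i where i: "l = x i \<or> l = y i" using V_cases[OF l] by metis
      show thesis
      proof (cases "even i")
        case True
        show thesis by (rule that[of i]) (use i True in auto)
      next
        case False
        show thesis by (rule that[of 0]) (use i False even_dvd in fastforce)+
      qed
    qed
    have y_odd: "y k \<in> C" if "odd k" for k
    proof -
      have eq: "y (c + 1) \<in> C \<longleftrightarrow> y (c + 3) \<in> C" "y (c + 3) \<in> C \<longleftrightarrow> y (c + 5) \<in> C"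
        "y (c + 5) \<in> C \<longleftrightarrow> y (c + 7) \<in> C"
        using pass[of "c + 2"] pass[of "c + 4"] pass[of "c + 6"] c dvd
        by (simp_all add: algebra_simps)
      have all: "y i \<in> C \<longleftrightarrow> y (c + 1) \<in> C" if "odd i" for i
      proof -
        define d where "d = (i - c) mod 8"
        have "int n dvd i - (c + d)" using n by (simp add: d_def mod_eq_dvd_iff flip: diff_diff_eq)
        then have "y i = y (c + d)" by simp
        moreover have "odd (i - c)" using that c(1) by simp
        then have "d = 1 \<or> d = 3 \<or> d = 5 \<or> d = 7"
          unfolding d_def by presburger
        ultimately show ?thesis using eq by (auto simp del: xy_eq)
      qed
      have "y 1 \<in> C" using C(2) by (simp add: S_def)
      then show ?thesis using all[of 1] all[OF that] by simp
    qed
    have x_odd_step: "x (k + 2) \<in> C" "x (k - 2) \<in> C" if "odd k" "x k \<noteq> l" "x k \<in> C" "x (k - 2) \<in> C \<or> x (k + 2) \<in> C" for k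
      using force_x(2,3)[of k] y_odd that by auto
    \<comment> \<open>Only a leak at an even \<open>x i\<close> can keep an even \<open>y k\<close> white; this \<open>y i\<close> is then
      the last vertex to be forced, by its neighbour \<open>y (i + 1)\<close>.\<close>
    have "x k \<in> C \<and> y k \<in> C" for k
    proof (cases "\<exists>i. even i \<and> l = x i")
      case True
      then obtain i where i: "even i" "l = x i" by blast
      have not_l: "x k \<noteq> l" "y j \<noteq> l" if "odd k" for k j
        using i that even_dvd by fastforce+
      have "x (i + 3) \<in> C" "x (i + 5) \<in> C"
        using force_y(1)[of "i + 3"] force_y(1)[of "i + 5"] y_odd[of "i + 3"] y_odd[of "i + 5"]
          y_even[of "i + 2"] y_even[of "i + 4"] y_even[of "i + 6"] i not_l[of 1] dvd
        by (auto simp: algebra_simps)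
      then have x: "x (i + 1) \<in> C" "x (i + 3) \<in> C" "x (i + 5) \<in> C" "x (i + 7) \<in> C"
        using x_odd_step[of "i + 3"] x_odd_step[of "i + 5"] not_l i(1)
        by (simp_all add: algebra_simps del: xy_eq)
      have x_odd: "x k \<in> C" if "odd k" for k
      proof -
        define d where "d = (k - i) mod 8"
        have "int n dvd k - (i + d)" using n by (simp add: d_def mod_eq_dvd_iff flip: diff_diff_eq)
        then have "x k = x (i + d)" by simp
        moreover have "odd (k - i)" using that i(1) by simp
        then have "d = 1 \<or> d = 3 \<or> d = 5 \<or> d = 7"
          unfolding d_def by presburger
        ultimately show ?thesis using x by (auto simp del: xy_eq)
      qed
      have "y k \<in> C" if "even k" for k
      proof (cases "x k = l")
        case True
        then have "x (k + 2) \<noteq> l" using dvd by auto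
        then have "y (k + 2) \<in> C" using y_even[of "k + 2"] that by simp
        then show ?thesis
          using force_y(3)[of "k + 1"] y_odd[of "k + 1"] x_odd[of "k + 1"] not_l(2)[of 1] that
          by (simp add: algebra_simps)
      qed (use y_even that in blast)
      then show ?thesis using x_odd x_even y_odd by blast
    next
      case False
      then have y: "y k \<in> C" for k using y_even y_odd by blast
      have x: "x k \<in> C" if "y k \<noteq> l" for k using force_y(1)[of k] y that by simp
      have "x k \<in> C"
      proof (cases "y k = l")
        case True
        then have "x (k + 2) \<noteq> l" "y (k + 2) \<noteq> l" "y (k + 4) \<noteq> l" using dvd by auto
        then show ?thesis using force_x(3)[of "k + 2"] x[of "k + 2"] x[of "k + 4"] y
            by (simp add: algebra_simps del: xy_eq)
      qed (rule x)
      with y show ?thesis by blast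
    qed
    then show "V \<subseteq> C" by (auto elim: V_cases)
  qed
qed

section \<open>Stalled sets in P(n, 2)\<close>

text \<open>The usual reason why a vertex of a set cannot force: all of its neighbours are blue, or two are
  white.\<close>

lemma stalledI:
  assumes "C \<subseteq> V" "\<And>b. b \<in> C \<Longrightarrow> N b \<subseteq> C \<or> (\<exists>u\<in>N b. \<exists>w\<in>N b. u \<noteq> w \<and> u \<notin> C \<and> w \<notin> C)"
  shows "stalled V E L C"
  unfolding stalled_def
proof (intro conjI ballI allI notI)
  fix b w assume "b \<in> C - L" "N b - C = {w}"
  then have b: "b \<in> C" "w \<in> N b" "w \<notin> C" "\<And>u. u \<in> N b \<Longrightarrow> u \<notin> C \<Longrightarrow> u = w" by blast+
  from assms(2)[OF b(1)] show False
    using b(2-3) b(4) by (elim disjE bexE conjE) (blast, metis)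
qed (fact assms(1))

text \<open>The closed neighbourhood of the 5-cycle \<open>y j\<close>, \<open>y (j + 1)\<close>, \<open>y (j + 2)\<close>, \<open>x (j + 2)\<close>, \<open>x j\<close>.\<close>

definition pentagon_hood :: "int \<Rightarrow> pvertex set" where
  "pentagon_hood j = {x (j - 2), y (j - 1), x j, y j, x (j + 1), y (j + 1), x (j + 2), y (j + 2), y (j + 3), x (j + 4)}"

text \<open>The closed neighbourhood of the path \<open>x (j - 2)\<close>, \<open>x j\<close>, \<open>x (j + 2)\<close>.\<close>

definition x_path_hood :: "int \<Rightarrow> pvertex set" where
  "x_path_hood j = {x (j - 4), x (j - 2), x j, x (j + 2), x (j + 4), y (j - 2), y j, y (j + 2)}"

text \<open>All columns of one parity. The notion is meaningful for even \<open>n\<close> only; for odd \<open>n\<close> it would give the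
  whole graph.\<close>

definition parity_class :: "int \<Rightarrow> pvertex set" where
  "parity_class j = {v. \<exists>k. even (k - j) \<and> (v = x k \<or> v = y k)}"

lemma parity_class_iff:
  assumes "even n"
  shows "x k \<in> parity_class j \<longleftrightarrow> even (k - j)" "y k \<in> parity_class j \<longleftrightarrow> even (k - j)"
proof -
  have "even (i - k)" if "int n dvd i - k" for i k
    using assms that by (meson dvd_trans even_of_nat)
  then have "even (k - j)" if "int n dvd k - i" "even (i - j)" for i
    using that by fastforce
  then show "x k \<in> parity_class j \<longleftrightarrow> even (k - j)" "y k \<in> parity_class j \<longleftrightarrow> even (k - j)"
    by (auto simp: parity_class_def intro: exI[of _ k])
qed

text \<open>Each of the five outer vertices has two white neighbours. For \<open>n = 8\<close> this fails, because
  \<open>x (j - 2)\<close> and \<open>x (j + 4)\<close> are then adjacent.\<close>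

lemma pentagon_hood_stalled:
  assumes "7 \<le> n" "n \<noteq> 8"
  shows "stalled V E L (pentagon_hood j)"
proof (rule stalledI)
  show "pentagon_hood j \<subseteq> V" by (simp add: pentagon_hood_def)
  fix b assume "b \<in> pentagon_hood j"
  then show "N b \<subseteq> pentagon_hood j \<or> (\<exists>u\<in>N b. \<exists>w\<in>N b. u \<noteq> w \<and> u \<notin> pentagon_hood j \<and> w \<notin> pentagon_hood j)"
    using not_dvd_upto_6_or_8[OF assms(1)] not_dvd_upto_6_or_8(7)[OF assms]
    by (auto simp: pentagon_hood_def N_x N_y algebra_simps)
qed

text \<open>The \<open>x\<close>-vertices have all their neighbours in the set, and the \<open>y\<close>-vertices have two outside.\<close>

lemma parity_class_stalled:
  assumes "even n"
  shows "stalled V E L (parity_class j)"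
proof (rule stalledI)
  show "parity_class j \<subseteq> V" by (auto simp: parity_class_def)
  fix b assume "b \<in> parity_class j"
  then obtain k where k: "even (k - j)" "b = x k \<or> b = y k" by (auto simp: parity_class_def)
  from k(2) show "N b \<subseteq> parity_class j \<or> (\<exists>u\<in>N b. \<exists>w\<in>N b. u \<noteq> w \<and> u \<notin> parity_class j \<and> w \<notin> parity_class j)"
  proof
    assume "b = x k"
    then show ?thesis using k(1) parity_class_iff[OF assms] by (simp add: N_x)
  next
    assume "b = y k"
    moreover have "y (k + 1) \<noteq> y (k - 1)" using n_ge not_dvd_small[of 2] by simp
    moreover have "y (k + 1) \<notin> parity_class j" "y (k - 1) \<notin> parity_class j"
      using k(1) parity_class_iff[OF assms] by simp_all
    ultimately show ?thesis by (simp add: N_y)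
  qed
qed

lemma x_path_hood_stalled:
  assumes "7 \<le> n" "odd n"
  shows "stalled V E L (x_path_hood j)"
proof (rule stalledI)
  show "x_path_hood j \<subseteq> V" by (simp add: x_path_hood_def)
  fix b assume "b \<in> x_path_hood j"
  moreover have "\<not> int n dvd 10"
    using dvd_below_double[of 10] assms by auto
  moreover have "n \<noteq> 8" using assms by auto
  ultimately show "N b \<subseteq> x_path_hood j \<or> (\<exists>u\<in>N b. \<exists>w\<in>N b. u \<noteq> w \<and> u \<notin> x_path_hood j \<and> w \<notin> x_path_hood j)"
    using not_dvd_upto_6_or_8[OF assms(1)]
    by (auto simp: x_path_hood_def N_x N_y algebra_simps)
qed

definition trapped :: "pvertex set \<Rightarrow> bool" where
  "trapped B \<longleftrightarrow> (\<exists>C. stalled V E {} C \<and> B \<subseteq> C \<and> C \<noteq> V)"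

lemma trapped_not_forcing: "trapped B \<Longrightarrow> \<not> (leaky_step V E L)\<^sup>*\<^sup>* B V"
proof
  assume "trapped B" and B: "(leaky_step V E L)\<^sup>*\<^sup>* B V"
  then obtain C where C: "stalled V E {} C" "B \<subseteq> C" "C \<noteq> V" by (auto simp: trapped_def)
  have "stalled V E L C" using C(1) by (rule stalled_mono) simp
  from forcing_confined_to_stalled[OF B this C(2)] this C(3) show False
    by (auto simp: stalled_def)
qed

lemma trapped_pentagon_hood:
  assumes "7 \<le> n" "n \<noteq> 8" "B \<subseteq> pentagon_hood j"
  shows "trapped B"
proof -
  have "x (j + 3) \<notin> pentagon_hood j" using not_dvd_upto_6_or_8[OF assms(1)] by (simp add: pentagon_hood_def)
  then have "pentagon_hood j \<noteq> V" by (metis xy_in_V(1))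
  with pentagon_hood_stalled[OF assms(1,2)] assms(3) show ?thesis unfolding trapped_def by blast
qed

lemma trapped_parity_class:
  assumes "even n" "B \<subseteq> parity_class j"
  shows "trapped B"
proof -
  have "x (j + 1) \<notin> parity_class j" using parity_class_iff[OF assms(1)] by simp
  then have "parity_class j \<noteq> V" by (metis xy_in_V(1))
  with parity_class_stalled[OF assms(1)] assms(2) show ?thesis unfolding trapped_def by blast
qed

text \<open>For even \<open>n\<close> the parity class is used instead, since for \<open>n = 10\<close> the vertices \<open>x (j + 4)\<close> and
  \<open>x (j - 4)\<close> are adjacent and the set is not stalled.\<close>

lemma trapped_x_path_hood:
  assumes "7 \<le> n" "B \<subseteq> x_path_hood j"
  shows "trapped B"
proof (cases "even n")
  case True
  have "x_path_hood j \<subseteq> parity_class j" using parity_class_iff[OF True] by (simp add: x_path_hood_def)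
  with trapped_parity_class[OF True, of B j] assms(2) show ?thesis by blast
next
  case False
  have "x (j + 1) \<notin> x_path_hood j" using not_dvd_upto_6_or_8[OF assms(1)] by (simp add: x_path_hood_def)
  then have "x_path_hood j \<noteq> V" by (metis xy_in_V(1))
  with x_path_hood_stalled[OF assms(1) False] assms(2) show ?thesis unfolding trapped_def by blast
qed

section \<open>Closed neighbourhoods\<close>

abbreviation cN where "cN v \<equiv> insert v (N v)"

lemma cN_sym: "u \<in> V \<Longrightarrow> v \<in> V \<Longrightarrow> u \<in> cN v \<longleftrightarrow> v \<in> cN u"
  by (auto simp: neighbors_def insert_commute)

lemma card_cN: "v \<in> V \<Longrightarrow> card (cN v) = 4"
  using not_dvd_upto_4 by (auto elim!: V_cases simp: N_x N_y)

text \<open>There are no triangles: these exist only for \<open>n = 6\<close>.\<close>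

lemma card_edge_cN:
  assumes "n \<noteq> 6" "u \<in> V" "v \<in> N u"
  shows "card (cN u \<union> cN v) = 6"
proof -
  have d: "\<not> int n dvd 6" using assms(1) n_ge dvd_below_double[of 6] by auto
  from assms(2,3) show ?thesis
  proof (cases rule: edge_cases)
    case (xx j)
    have "card (cN (x j) \<union> cN (x (j + 2))) = 6"
      using not_dvd_upto_4 d by (simp add: N_x N_y algebra_simps card_insert_if)
    with xx show ?thesis by (auto simp: doubleton_eq_iff Un_commute insert_commute simp del: xy_eq)
  next
    case (xy j)
    have "card (cN (x j) \<union> cN (y j)) = 6"
      using not_dvd_upto_4 d by (simp add: N_x N_y algebra_simps card_insert_if)
    with xy show ?thesis by (auto simp: doubleton_eq_iff Un_commute insert_commute simp del: xy_eq)
  next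
    case (yy j)
    have "card (cN (y j) \<union> cN (y (j + 1))) = 6"
      using not_dvd_upto_4 d by (simp add: N_x N_y algebra_simps card_insert_if)
    with yy show ?thesis by (auto simp: doubleton_eq_iff Un_commute insert_commute simp del: xy_eq)
  qed
qed

lemma no_four_cycle:
  assumes "n \<noteq> 6" "n \<noteq> 8" "a \<in> V" "c \<in> N a" "d \<in> N a" "c \<noteq> d" "b \<in> N c" "b \<in> N d"
  shows "b = a"
proof -
  have "\<not> int n dvd 6" "\<not> int n dvd 8"
    using assms(1,2) n_ge dvd_below_double[of 6] dvd_below_double[of 8] by auto
  with assms(3-) not_dvd_upto_4 show ?thesis
    by (auto elim!: V_cases simp: N_x N_y algebra_simps)
qed

text \<open>A second common neighbour of two non-adjacent vertices would close a 4-cycle.\<close>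

lemma card_common_cN:
  assumes "n \<noteq> 6" "n \<noteq> 8" "u \<in> V" "v \<in> V" "u \<noteq> v" "v \<notin> N u"
  shows "card (cN u \<inter> cN v) \<le> 1"
proof -
  have "c = d" if "c \<in> cN u \<inter> cN v" "d \<in> cN u \<inter> cN v" for c d
  proof (rule ccontr)
    assume "c \<noteq> d"
    have "u \<notin> N v" using cN_sym[OF assms(3,4)] assms(5,6) by auto
    with that assms(5,6) have "c \<in> N u" "c \<in> N v" "d \<in> N u" "d \<in> N v" by auto
    moreover from this have "v \<in> N c" "v \<in> N d"
      using assms(4) by (auto simp: neighbors_def insert_commute)
    ultimately show False
      using no_four_cycle[OF assms(1-3), of c d v] \<open>c \<noteq> d\<close> assms(5) by blast
  qed
  then have "is_singleton (cN u \<inter> cN v) \<or> cN u \<inter> cN v = {}"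
    by (metis is_singletonI' )
  then show ?thesis by (auto simp: is_singleton_altdef)
qed

lemma sharing_cN_near:
  assumes "w \<in> V" "u \<in> V" "v \<in> V" "2 \<le> card (cN w \<inter> (cN u \<union> cN v))"
  obtains e where "e \<in> cN u \<union> cN v" "w \<in> cN e"
proof -
  have "cN w \<inter> (cN u \<union> cN v) \<noteq> {}" using assms(4) by auto
  then obtain e where e: "e \<in> cN w" "e \<in> cN u \<union> cN v" by blast
  moreover have "e \<in> V" using e(1) assms(1) by (auto simp: neighbors_def)
  ultimately show thesis using that cN_sym assms(1) by blast
qed

section \<open>Two forcers: n = 5 and n = 8\<close>

text \<open>The closed neighbourhood of an edge is stalled, as each of its four outer vertices has two white
  neighbours. The exception is an edge between \<open>x\<close>-vertices for \<open>n = 8\<close>, where these lie on a 4-cycle; then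
  a parity class contains everything.\<close>

lemma edge_trapped:
  assumes "n = 5 \<or> n = 8" "u \<in> V" "v \<in> N u"
  shows "trapped (cN u \<union> cN v)"
proof -
  have d: "\<not> int n dvd 6" using assms(1) dvd_below_double[of 6] by auto
  let ?T = "cN u \<union> cN v"
  have trap: "trapped ?T" if "stalled V E {} ?T"
  proof -
    have "card ?T = 6" using card_edge_cN[OF _ assms(2,3)] assms(1) by auto
    then have "?T \<noteq> V" using card_V n_ge by auto
    with that show ?thesis unfolding trapped_def by blast
  qed
  have stalledI': "stalled V E {} B" if "B \<subseteq> V" "\<forall>b\<in>B. N b \<subseteq> B \<or> (\<exists>u\<in>N b. \<exists>w\<in>N b. u \<noteq> w \<and> u \<notin> B \<and> w \<notin> B)" for B
    using that by (intro stalledI) auto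
  from assms(2,3) show ?thesis
  proof (cases rule: edge_cases)
    case (xx j)
    show ?thesis
    proof (cases "n = 8")
      case True
      then have "even n" by simp
      then have "cN (x j) \<union> cN (x (j + 2)) \<subseteq> parity_class j"
        using parity_class_iff[of _ j] by (simp add: N_x)
      then have "trapped (cN (x j) \<union> cN (x (j + 2)))" using trapped_parity_class \<open>even n\<close> by blast
      with xx show ?thesis by (auto simp: doubleton_eq_iff Un_commute insert_commute simp del: xy_eq)
    next
      case False
      then have "\<not> int n dvd 8" using assms(1) dvd_below_double[of 8] by auto
      then have "stalled V E {} (cN (x j) \<union> cN (x (j + 2)))"
        using d not_dvd_upto_4 by (intro stalledI') (simp_all add: N_x N_y algebra_simps)
      with xx trap show ?thesis by (auto simp: doubleton_eq_iff Un_commute insert_commute simp del: xy_eq)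
    qed
  next
    case (xy j)
    have "stalled V E {} (cN (x j) \<union> cN (y j))"
      using d not_dvd_upto_4 by (intro stalledI') (simp_all add: N_x N_y algebra_simps)
    with xy trap show ?thesis by (auto simp: doubleton_eq_iff Un_commute insert_commute simp del: xy_eq)
  next
    case (yy j)
    have "stalled V E {} (cN (y j) \<union> cN (y (j + 1)))"
      using d not_dvd_upto_4 by (intro stalledI') (simp_all add: N_x N_y algebra_simps)
    with yy trap show ?thesis by (auto simp: doubleton_eq_iff Un_commute insert_commute simp del: xy_eq)
  qed
qed

lemma eight_four_cycle:
  assumes "n = 8" "u \<in> V" "c \<in> N u" "d \<in> N u" "c \<noteq> d" "v \<in> N c" "v \<in> N d" "v \<noteq> u"
  shows "\<exists>j. u = x j \<and> v = x (j + 4)"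
proof -
  have d: "\<not> int n dvd 1" "\<not> int n dvd 2" "\<not> int n dvd 3" "\<not> int n dvd 4" "\<not> int n dvd 5" "\<not> int n dvd 6"
     "int n dvd 8"
    using not_dvd_upto_6_or_8 assms(1) by simp_all
  from assms(2) show ?thesis
  proof (cases rule: V_cases)
    case (x j)
    have "x (j - 4) = x (j + 4)" using d by simp
    with x assms(3-) d have "v = x (j + 4)"
      by (auto simp: N_x N_y algebra_simps)
    with x show ?thesis by blast
  next
    case (y j)
    with assms(3-) d show ?thesis
      by (auto simp: N_x N_y algebra_simps)
  qed
qed

text \<open>Each closed neighbourhood has four vertices, so the two forcers must share two of them. They are thus
  adjacent or opposite on a 4-cycle, and \<open>B\<close> is exactly the union of their closed neighbourhoods.\<close>

lemma two_forcers_trapped: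
  assumes "n = 5 \<or> n = 8" "u \<in> V" "v \<in> V" "u \<noteq> v" "cN u \<union> cN v \<subseteq> B" "finite B" "card B \<le> 6"
  shows "trapped B"
proof -
  let ?T = "cN u \<union> cN v"
  have tight: "B = ?T" if "card ?T = 6"
    using card_seteq[OF assms(6,5)] that assms(7) by simp
  have sum: "card ?T + card (cN u \<inter> cN v) = 8"
    using card_Un_Int[of "cN u" "cN v"] card_cN assms(2,3) by simp
  have "card ?T \<le> 6" using card_mono[OF assms(6,5)] assms(7) by linarith
  with sum have common: "\<not> card (cN u \<inter> cN v) \<le> 1" by linarith
  show ?thesis
  proof (cases "v \<in> N u")
    case True
    then have "card ?T = 6" using card_edge_cN[OF _ assms(2)] assms(1) by auto
    with tight edge_trapped[OF assms(1,2) True] show ?thesis by simp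
  next
    case False
    with common card_common_cN[OF _ _ assms(2-4)] assms(1) have "n = 8" by auto
    have "u \<notin> N v" using False assms(2,3) by (auto simp: neighbors_def insert_commute)
    obtain c d where "c \<in> cN u \<inter> cN v" "d \<in> cN u \<inter> cN v" "c \<noteq> d"
      using common card_le_Suc0_iff_eq[of "cN u \<inter> cN v"] by auto
    with False \<open>u \<notin> N v\<close> assms(4) have cd: "c \<in> N u" "d \<in> N u" "c \<noteq> d" "c \<in> N v" "d \<in> N v" by auto
    then have "v \<in> N c" "v \<in> N d" using assms(3) by (auto simp: neighbors_def insert_commute)
    with eight_four_cycle[OF \<open>n = 8\<close> assms(2) cd(1-3)] assms(4)
    obtain j where j: "u = x j" "v = x (j + 4)" by blast
    have d: "\<not> int n dvd 6" "int n dvd 8" using \<open>n = 8\<close> dvd_below_double[of 6] by auto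
    have "card ?T = 6"
      unfolding j using d not_dvd_upto_4 by (simp add: N_x N_y algebra_simps card_insert_if)
    moreover have "even n" using \<open>n = 8\<close> by simp
    then have "?T \<subseteq> parity_class j"
      unfolding j using parity_class_iff[of _ j] by (simp add: N_x)
    ultimately show ?thesis using tight trapped_parity_class[OF \<open>even n\<close>, of B j] by simp
  qed
qed

lemma leaky_forcing_lower_bound_5:
  assumes "n = 5 \<or> n = 8" "leaky_forcing_set 1 V E S"
  shows "\<not> card S < 5"
proof
  assume S: "card S < 5"
  have "(leaky_step V E {x 0})\<^sup>*\<^sup>* S V" "S \<subseteq> V"
    using assms(2) by (auto simp: leaky_forcing_set_def)
  from forcers_within_blue[OF finite_V this(2,1), of 2]
  obtain B I where B: "(leaky_step V E {x 0})\<^sup>*\<^sup>* B V" "B \<subseteq> V" "card B = card S + 2"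
    and I: "card I = 2" "I \<subseteq> B" "\<forall>b\<in>I. N b \<subseteq> B"
    using S card_V n_ge by auto
  from I(1) obtain u v where "I = {u, v}" "u \<noteq> v"
    by (metis card_2_iff)
  with I B S finite_subset[OF B(2) finite_V] have "trapped B"
    by (intro two_forcers_trapped[OF assms(1), of u v]) auto
  with trapped_not_forcing B(1) show False by blast
qed

section \<open>Three forcers: n = 7 and n at least 9\<close>

text \<open>Pairwise non-adjacent vertices share at most one neighbour per pair, which leaves at least
  \<open>12 - 3 = 9\<close> vertices in the union.\<close>

lemma three_with_few_neighbors:
  assumes "n \<noteq> 6" "n \<noteq> 8" "{u, v, w} \<subseteq> V" "u \<noteq> v" "u \<noteq> w" "v \<noteq> w"
    "card (cN w \<union> (cN u \<union> cN v)) \<le> 8"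
  shows "v \<in> N u \<or> w \<in> N u \<or> w \<in> N v"
proof (rule ccontr)
  assume "\<not> ?thesis"
  then have c: "card (cN u \<inter> cN v) \<le> 1" "card (cN u \<inter> cN w) \<le> 1" "card (cN v \<inter> cN w) \<le> 1"
    using assms(3-6) by (intro card_common_cN[OF assms(1,2)]; blast)+
  have "card (cN u \<union> cN v) + card (cN u \<inter> cN v) = 8"
    using card_Un_Int[of "cN u" "cN v"] card_cN assms(3) by simp
  moreover have "card (cN w \<union> (cN u \<union> cN v)) + card (cN w \<inter> (cN u \<union> cN v)) = 4 + card (cN u \<union> cN v)"
    using card_Un_Int[of "cN w" "cN u \<union> cN v"] card_cN assms(3) by simp
  moreover have "card (cN w \<inter> (cN u \<union> cN v)) \<le> card (cN u \<inter> cN w) + card (cN v \<inter> cN w)"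
    using card_Un_le[of "cN u \<inter> cN w" "cN v \<inter> cN w"] by (simp only: Int_Un_distrib Int_commute[of "cN w"])
  ultimately show False using c assms(7) by linarith
qed

text \<open>A third vertex that shares two vertices with the closed neighbourhood of an edge either extends the
  edge to a path or is opposite to the edge on a 5-cycle. The three lemmas for the three kinds of edges
  list these vertices; the candidates are those within distance one of the closed neighbourhood. For
  \<open>n = 10\<close> the \<open>x\<close>-vertices of one parity form an additional 5-cycle.\<close>

lemma third_near_xx:
  assumes "7 \<le> n" "n \<noteq> 8" "w \<in> V" "w \<notin> {x j, x (j + 2)}"
    "2 \<le> card (cN w \<inter> (cN (x j) \<union> cN (x (j + 2))))"
  shows "w \<in> {x (j - 2), x (j + 4), y j, y (j + 2), y (j + 1)} \<or> n = 10 \<and> w = x (j + 6)"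
proof -
  obtain e where e: "e \<in> cN (x j) \<union> cN (x (j + 2))" "w \<in> cN e"
    using sharing_cN_near[OF assms(3) _ _ assms(5)] by auto
  from e(1) have "e \<in> {x j, y j, x (j + 2), x (j - 2), y (j + 2), x (j + 4)}"
    by (simp add: N_x N_y algebra_simps del: xy_eq) blast
  then have "w \<in> {x j, x (j + 2), x (j - 2), x (j + 4), y j, y (j + 2), y (j + 1)} \<union>
      {y (j - 1), y (j - 2), x (j - 4), y (j + 3), y (j + 4), x (j + 6)}"
    using e(2) by (elim insertE emptyE; simp add: N_x N_y algebra_simps del: xy_eq; blast)
  then consider "w \<in> {x (j - 2), x (j + 4), y j, y (j + 2), y (j + 1)}" | "w \<in> {y (j - 1), y (j - 2), x (j - 4), y (j + 3), y (j + 4), x (j + 6)}"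
    using assms(4) by blast
  then show ?thesis
  proof cases
    case 2
    then show ?thesis
      using assms(2,5) not_dvd_upto_6_or_8[OF assms(1)] dvd_7_8_10[OF assms(1)]
      by (elim insertE emptyE; simp add: N_x N_y algebra_simps Int_insert_left split: if_splits)
  qed blast
qed

lemma third_near_xy:
  assumes "7 \<le> n" "n \<noteq> 8" "w \<in> V" "w \<notin> {x j, y j}"
    "2 \<le> card (cN w \<inter> (cN (x j) \<union> cN (y j)))"
  shows "w \<in> {x (j + 2), x (j - 2), y (j + 1), y (j - 1), y (j + 2), y (j - 2)}"
proof -
  obtain e where e: "e \<in> cN (x j) \<union> cN (y j)" "w \<in> cN e"
    using sharing_cN_near[OF assms(3) _ _ assms(5)] by auto
  from e(1) have "e \<in> {x j, y j, x (j + 2), x (j - 2), y (j + 1), y (j - 1)}"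
    by (simp add: N_x N_y algebra_simps del: xy_eq) blast
  then have "w \<in> {x j, y j, x (j + 2), x (j - 2), y (j + 1), y (j - 1), y (j + 2), y (j - 2)} \<union>
      {x (j + 4), x (j - 4), x (j + 1), x (j - 1)}"
    using e(2) by (elim insertE emptyE; simp add: N_x N_y algebra_simps del: xy_eq; blast)
  then consider "w \<in> {x (j + 2), x (j - 2), y (j + 1), y (j - 1), y (j + 2), y (j - 2)}" | "w \<in> {x (j + 4), x (j - 4), x (j + 1), x (j - 1)}"
    using assms(4) by blast
  then show ?thesis
  proof cases
    case 2
    then show ?thesis
      using assms(2,5) not_dvd_upto_6_or_8[OF assms(1)] dvd_7_8_10[OF assms(1)]
      by (elim insertE emptyE; simp add: N_x N_y algebra_simps Int_insert_left split: if_splits)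
  qed blast
qed

lemma third_near_yy:
  assumes "7 \<le> n" "n \<noteq> 8" "w \<in> V" "w \<notin> {y j, y (j + 1)}"
    "2 \<le> card (cN w \<inter> (cN (y j) \<union> cN (y (j + 1))))"
  shows "w \<in> {y (j - 1), y (j + 2), x j, x (j + 1), x (j + 2), x (j - 1)}"
proof -
  obtain e where e: "e \<in> cN (y j) \<union> cN (y (j + 1))" "w \<in> cN e"
    using sharing_cN_near[OF assms(3) _ _ assms(5)] by auto
  from e(1) have "e \<in> {y j, x j, y (j + 1), y (j - 1), x (j + 1), y (j + 2)}"
    by (simp add: N_x N_y algebra_simps del: xy_eq) blast
  then have "w \<in> {y j, y (j + 1), y (j - 1), y (j + 2), x j, x (j + 1), x (j + 2), x (j - 1)} \<union>
      {x (j - 2), y (j - 2), x (j + 3), y (j + 3)}"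
    using e(2) by (elim insertE emptyE; simp add: N_x N_y algebra_simps del: xy_eq; blast)
  then consider "w \<in> {y (j - 1), y (j + 2), x j, x (j + 1), x (j + 2), x (j - 1)}" | "w \<in> {x (j - 2), y (j - 2), x (j + 3), y (j + 3)}"
    using assms(4) by blast
  then show ?thesis
  proof cases
    case 2
    then show ?thesis
      using assms(2,5) not_dvd_upto_6_or_8[OF assms(1)] dvd_7_8_10[OF assms(1)]
      by (elim insertE emptyE; simp add: N_x N_y algebra_simps Int_insert_left split: if_splits)
  qed blast
qed

text \<open>In each of the listed cases, the path or 5-cycle decides which stalled set contains the three closed
  neighbourhoods. That their union has as many as eight vertices makes it equal to a blue set of eight
  vertices around the three forcers.\<close>

lemma third_trapped_xx:
  assumes "7 \<le> n" "n \<noteq> 8" "w \<in> V" "w \<notin> {x j, x (j + 2)}"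
    "2 \<le> card (cN w \<inter> (cN (x j) \<union> cN (x (j + 2))))"
  shows "card (cN w \<union> (cN (x j) \<union> cN (x (j + 2)))) = 8 \<and> trapped (cN w \<union> (cN (x j) \<union> cN (x (j + 2))))"
proof -
  note facts = assms(2) not_dvd_upto_6_or_8[OF assms(1)] dvd_7_8_10[OF assms(1)]
  let ?I = "cN w \<union> (cN (x j) \<union> cN (x (j + 2)))"
  from third_near_xx[OF assms]
  consider "w = x (j - 2)" | "w = x (j + 4)" | "w \<in> {y j, y (j + 2), y (j + 1)}" | "n = 10" "w = x (j + 6)"
    by blast
  then show ?thesis
  proof cases
    case 1
    then have "?I \<subseteq> x_path_hood j" "card ?I = 8"
      using facts by (simp_all add: x_path_hood_def N_x N_y algebra_simps card_insert_if)
    then show ?thesis using trapped_x_path_hood assms by blast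
  next
    case 2
    then have "?I \<subseteq> x_path_hood (j + 2)" "card ?I = 8"
      using facts by (simp_all add: x_path_hood_def N_x N_y algebra_simps card_insert_if)
    then show ?thesis using trapped_x_path_hood assms by blast
  next
    case 3
    then have "?I \<subseteq> pentagon_hood j \<and> card ?I = 8"
      using facts by (elim insertE emptyE; simp add: pentagon_hood_def N_x N_y algebra_simps card_insert_if)
    then show ?thesis using trapped_pentagon_hood assms by blast
  next
    \<comment> \<open>the five \<open>x\<close>-vertices with the parity of \<open>j\<close> form a cycle\<close>
    case 4
    have "even n" "int n dvd 10" using 4(1) by auto
    then have "?I \<subseteq> parity_class j" "card ?I = 8"
      using 4(2) not_dvd_upto_6_or_8[OF assms(1)] not_dvd_upto_6_or_8(7)[OF assms(1,2)] parity_class_iff[of _ j]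
      by (simp_all add: N_x N_y algebra_simps card_insert_if)
    then show ?thesis using trapped_parity_class \<open>even n\<close> by blast
  qed
qed

lemma third_trapped_xy:
  assumes "7 \<le> n" "n \<noteq> 8" "w \<in> V" "w \<notin> {x j, y j}"
    "2 \<le> card (cN w \<inter> (cN (x j) \<union> cN (y j)))"
  shows "card (cN w \<union> (cN (x j) \<union> cN (y j))) = 8 \<and> trapped (cN w \<union> (cN (x j) \<union> cN (y j)))"
proof -
  note facts = assms(2) not_dvd_upto_6_or_8[OF assms(1)] dvd_7_8_10[OF assms(1)]
  let ?I = "cN w \<union> (cN (x j) \<union> cN (y j))"
  from third_near_xy[OF assms]
  consider "w \<in> {x (j + 2), y (j + 1), y (j + 2)}" | "w \<in> {x (j - 2), y (j - 1), y (j - 2)}"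
    by blast
  then show ?thesis
  proof cases
    case 1
    then have "?I \<subseteq> pentagon_hood j \<and> card ?I = 8"
      using facts by (elim insertE emptyE; simp add: pentagon_hood_def N_x N_y algebra_simps card_insert_if)
    then show ?thesis using trapped_pentagon_hood assms by blast
  next
    case 2
    then have "?I \<subseteq> pentagon_hood (j - 2) \<and> card ?I = 8"
      using facts by (elim insertE emptyE; simp add: pentagon_hood_def N_x N_y algebra_simps card_insert_if)
    then show ?thesis using trapped_pentagon_hood assms by blast
  qed
qed

lemma third_trapped_yy:
  assumes "7 \<le> n" "n \<noteq> 8" "w \<in> V" "w \<notin> {y j, y (j + 1)}"
    "2 \<le> card (cN w \<inter> (cN (y j) \<union> cN (y (j + 1))))"
  shows "card (cN w \<union> (cN (y j) \<union> cN (y (j + 1)))) = 8 \<and> trapped (cN w \<union> (cN (y j) \<union> cN (y (j + 1))))"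
proof -
  note facts = assms(2) not_dvd_upto_6_or_8[OF assms(1)] dvd_7_8_10[OF assms(1)]
  let ?I = "cN w \<union> (cN (y j) \<union> cN (y (j + 1)))"
  from third_near_yy[OF assms]
  consider "w \<in> {x j, y (j + 2), x (j + 2)}" | "w \<in> {x (j + 1), y (j - 1), x (j - 1)}"
    by blast
  then show ?thesis
  proof cases
    case 1
    then have "?I \<subseteq> pentagon_hood j \<and> card ?I = 8"
      using facts by (elim insertE emptyE; simp add: pentagon_hood_def N_x N_y algebra_simps card_insert_if)
    then show ?thesis using trapped_pentagon_hood assms by blast
  next
    case 2
    then have "?I \<subseteq> pentagon_hood (j - 1) \<and> card ?I = 8"
      using facts by (elim insertE emptyE; simp add: pentagon_hood_def N_x N_y algebra_simps card_insert_if)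
    then show ?thesis using trapped_pentagon_hood assms by blast
  qed
qed

lemma third_trapped:
  assumes "7 \<le> n" "n \<noteq> 8" "u \<in> V" "v \<in> N u" "w \<in> V" "w \<noteq> u" "w \<noteq> v"
    "2 \<le> card (cN w \<inter> (cN u \<union> cN v))"
  shows "card (cN w \<union> (cN u \<union> cN v)) = 8 \<and> trapped (cN w \<union> (cN u \<union> cN v))"
  using assms(3,4)
proof (cases rule: edge_cases)
  case (xx j)
  then show ?thesis using third_trapped_xx[OF assms(1,2,5), of j] assms(6-8)
    by (auto simp: doubleton_eq_iff Un_commute insert_commute simp del: xy_eq)
next
  case (xy j)
  then show ?thesis using third_trapped_xy[OF assms(1,2,5), of j] assms(6-8)
    by (auto simp: doubleton_eq_iff Un_commute insert_commute simp del: xy_eq)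
next
  case (yy j)
  then show ?thesis using third_trapped_yy[OF assms(1,2,5), of j] assms(6-8)
    by (auto simp: doubleton_eq_iff Un_commute insert_commute simp del: xy_eq)
qed

lemma three_forcers_trapped:
  assumes "7 \<le> n" "n \<noteq> 8" "{u, v, w} \<subseteq> V" "u \<noteq> v" "u \<noteq> w" "v \<noteq> w" 
    "cN u \<union> cN v \<union> cN w \<subseteq> B" "finite B" "card B \<le> 8"
  shows "trapped B"
proof -
  have adj: "trapped B" if "{a, b, c} = {u, v, w}" "b \<in> N a" "c \<noteq> a" "c \<noteq> b" for a b c
  proof -
    have V: "a \<in> V" "b \<in> V" "c \<in> V" using that(1) assms(3) by blast+
    let ?I = "cN c \<union> (cN a \<union> cN b)"
    have "?I = (\<Union>v\<in>{a, b, c}. cN v)" by auto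
    also have "\<dots> \<subseteq> B" unfolding that(1) using assms(7) by auto
    finally have I: "?I \<subseteq> B" .
    then have "card ?I \<le> 8" using card_mono[OF assms(8)] assms(9) by (meson le_trans)
    moreover have "card ?I + card (cN c \<inter> (cN a \<union> cN b)) = 4 + 6"
      using card_Un_Int[of "cN c" "cN a \<union> cN b"] card_cN V card_edge_cN[OF _ V(1) that(2)] assms(1) by simp
    \<comment> \<open>the vertex \<open>c\<close> shares at least two vertices with the edge, since \<open>10 - 8 = 2\<close>\<close>
    ultimately have "card ?I = 8 \<and> trapped ?I"
      using that V assms(1,2) by (intro third_trapped) auto
    moreover from this have "?I = B" using card_seteq[OF assms(8) I] assms(9) by linarith
    ultimately show ?thesis by simp
  qed
  have "card (cN w \<union> (cN u \<union> cN v)) \<le> card B" using assms(7,8) by (intro card_mono) auto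
  then consider "v \<in> N u" | "w \<in> N u" | "w \<in> N v"
    using three_with_few_neighbors[of u v w] assms by force
  then show ?thesis
    using adj[of u v w] adj[of u w v] adj[of v w u] assms(4-6) by cases blast+
qed

lemma leaky_forcing_lower_bound_6:
  assumes "7 \<le> n" "n \<noteq> 8" "leaky_forcing_set 1 V E S"
  shows "\<not> card S < 6"
proof
  assume S: "card S < 6"
  \<comment> \<open>any leak will do, because stalled sets without leaks remain stalled\<close>
  have "(leaky_step V E {x 0})\<^sup>*\<^sup>* S V" "S \<subseteq> V"
    using assms(3) by (auto simp: leaky_forcing_set_def)
  from forcers_within_blue[OF finite_V this(2,1), of 3]
  obtain B I where B: "(leaky_step V E {x 0})\<^sup>*\<^sup>* B V" "B \<subseteq> V" "card B = card S + 3"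
    and I: "card I = 3" "I \<subseteq> B" "\<forall>b\<in>I. N b \<subseteq> B"
    using S card_V assms(1) by auto
  from I(1) obtain u v w where "I = {u, v, w}" "u \<noteq> v" "u \<noteq> w" "v \<noteq> w"
    by (metis card_3_iff)
  with I B S finite_subset[OF B(2) finite_V] have "trapped B"
    by (intro three_forcers_trapped[OF assms(1,2), of u v w]) auto
  with trapped_not_forcing B(1) show False by blast
qed

section \<open>Leaky forts: n = 6\<close>

text \<open>Blue can enter a white set \<open>F\<close> only through an outside vertex with exactly one neighbour in \<open>F\<close>, and
  here the only such vertex is the leak.\<close>

lemma leaky_fort_hit:
  assumes "leaky_forcing_set 1 V E S" "l \<in> V" "F \<subseteq> V" "F \<noteq> {}"
    and "\<And>b w. b \<in> V - F \<Longrightarrow> b \<noteq> l \<Longrightarrow> N b \<inter> F \<noteq> {w}"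
  shows "\<exists>v\<in>F. v \<in> S"
proof (rule ccontr)
  assume "\<not> ?thesis"
  moreover have S: "S \<subseteq> V" "(leaky_step V E {l})\<^sup>*\<^sup>* S V"
    using assms(1,2) by (auto simp: leaky_forcing_set_def)
  ultimately have "S \<subseteq> V - F" by blast
  moreover have "stalled V E {l} (V - F)"
    unfolding stalled_def
  proof (intro conjI ballI allI)
    fix b w assume b: "b \<in> V - F - {l}"
    have "N b - (V - F) = N b \<inter> F" by (auto simp: neighbors_def)
    then show "N b - (V - F) \<noteq> {w}" using assms(5)[of b w] b by simp
  qed simp
  ultimately have "V \<subseteq> V - F" using forcing_confined_to_stalled[OF S(2)] by blast
  with assms(3,4) show False by blast
qed

lemma V_six:
  assumes "n = 6"
  shows "V = {x j, x (j + 1), x (j + 2), x (j + 3), x (j + 4), x (j + 5),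
    y j, y (j + 1), y (j + 2), y (j + 3), y (j + 4), y (j + 5)}"
proof -
  have "x k \<in> {x j, x (j + 1), x (j + 2), x (j + 3), x (j + 4), x (j + 5)} \<and>
    y k \<in> {y j, y (j + 1), y (j + 2), y (j + 3), y (j + 4), y (j + 5)}" for k
  proof -
    define d where "d = (k - j) mod 6"
    have "int n dvd k - (j + d)" using assms by (simp add: d_def mod_eq_dvd_iff flip: diff_diff_eq)
    then have "x k = x (j + d)" "y k = y (j + d)" by simp_all
    moreover have "d = 0 \<or> d = 1 \<or> d = 2 \<or> d = 3 \<or> d = 4 \<or> d = 5"
      unfolding d_def by presburger
    ultimately show ?thesis by (elim disjE) (simp_all del: xy_eq)
  qed
  then have "v \<in> {x j, x (j + 1), x (j + 2), x (j + 3), x (j + 4), x (j + 5)} \<union>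
    {y j, y (j + 1), y (j + 2), y (j + 3), y (j + 4), y (j + 5)}" if "v \<in> V" for v
    using that by (metis V_cases UnI1 UnI2)
  then show ?thesis by (intro equalityI subsetI) (blast, auto simp del: xy_eq)
qed

lemma dvd_six:
  assumes "n = 6"
  shows "\<not> int n dvd 1" "\<not> int n dvd 2" "\<not> int n dvd 3" "\<not> int n dvd 4" "\<not> int n dvd 5" "int n dvd 6"
    "\<not> int n dvd 7" "\<not> int n dvd 8"
  using assms by simp_all

text \<open>Five families of sets that a leaky forcing set must meet. In the second family no outside vertex has
  exactly one neighbour in the set; in the others one vertex has, and it is made the leak.\<close>

lemma six_forts:
  assumes "n = 6" "leaky_forcing_set 1 V E S"
  shows "x j \<in> S \<or> x (j + 2) \<in> S \<or> y (j + 1) \<in> S"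
    and "x j \<in> S \<or> y j \<in> S \<or> y (j + 2) \<in> S \<or> y (j + 4) \<in> S"
    and "x j \<in> S \<or> x (j + 3) \<in> S \<or> x (j + 5) \<in> S \<or> y j \<in> S \<or> y (j + 2) \<in> S"
    and "x j \<in> S \<or> x (j + 3) \<in> S \<or> x (j + 1) \<in> S \<or> y j \<in> S \<or> y (j + 4) \<in> S"
    and "x j \<in> S \<or> x (j + 1) \<in> S \<or> x (j + 2) \<in> S \<or> y (j + 3) \<in> S \<or> y (j + 5) \<in> S"
proof -
  have *: "\<exists>v\<in>F. v \<in> S" if "l \<in> V" "F \<subseteq> V" "F \<noteq> {}"
    "\<forall>b\<in>{x j, x (j + 1), x (j + 2), x (j + 3), x (j + 4), x (j + 5),
     y j, y (j + 1), y (j + 2), y (j + 3), y (j + 4), y (j + 5)}. b \<in> F \<or> b = l \<or> (\<forall>w. N b \<inter> F \<noteq> {w})" for l F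
    using leaky_fort_hit[OF assms(2) that(1-3)] that(4) V_six[OF assms(1), of j] by blast
  show "x j \<in> S \<or> x (j + 2) \<in> S \<or> y (j + 1) \<in> S"
    using *[of "x (j + 1)" "{x j, x (j + 2), y (j + 1)}"] dvd_six[OF assms(1)]
    by (simp add: N_x N_y algebra_simps Int_insert_left doubleton_eq_iff)
  show "x j \<in> S \<or> y j \<in> S \<or> y (j + 2) \<in> S \<or> y (j + 4) \<in> S"
    using *[of "x j" "{x j, y j, y (j + 2), y (j + 4)}"] dvd_six[OF assms(1)]
    by (simp add: N_x N_y algebra_simps Int_insert_left doubleton_eq_iff)
  show "x j \<in> S \<or> x (j + 3) \<in> S \<or> x (j + 5) \<in> S \<or> y j \<in> S \<or> y (j + 2) \<in> S"
    using *[of "x (j + 4)" "{x j, x (j + 3), x (j + 5), y j, y (j + 2)}"] dvd_six[OF assms(1)]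
    by (simp add: N_x N_y algebra_simps Int_insert_left doubleton_eq_iff)
  show "x j \<in> S \<or> x (j + 3) \<in> S \<or> x (j + 1) \<in> S \<or> y j \<in> S \<or> y (j + 4) \<in> S"
    using *[of "x (j + 2)" "{x j, x (j + 3), x (j + 1), y j, y (j + 4)}"] dvd_six[OF assms(1)]
    by (simp add: N_x N_y algebra_simps Int_insert_left doubleton_eq_iff)
  show "x j \<in> S \<or> x (j + 1) \<in> S \<or> x (j + 2) \<in> S \<or> y (j + 3) \<in> S \<or> y (j + 5) \<in> S"
    using *[of "y (j + 1)" "{x j, x (j + 1), x (j + 2), y (j + 3), y (j + 5)}"] dvd_six[OF assms(1)]
    by (simp add: N_x N_y algebra_simps Int_insert_left doubleton_eq_iff)
qed

text \<open>The vertices counted by \<open>p\<close> and those counted by \<open>q\<close> are two halves of the graph that a rotation by one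
  exchanges. The forts of the first family inside the \<open>p\<close>-half consist of two of its \<open>x\<close>-vertices and the
  \<open>y\<close>-vertex between them, so they need two vertices. Two vertices suffice for them only if these are
  two \<open>x\<close>-vertices or some \<open>x k\<close> and \<open>y (k + 3)\<close>. In both cases the remaining forts that they miss demand
  all three \<open>x\<close>-vertices of the \<open>q\<close>-half and one of its \<open>y\<close>-vertices.\<close>

lemma six_halves:
  fixes S :: "pvertex set" and j :: int
  assumes "n = 6" "leaky_forcing_set 1 V E S"
  defines "c \<equiv> \<lambda>k. of_bool (x k \<in> S) :: nat" and "d \<equiv> \<lambda>k. of_bool (y k \<in> S) :: nat"
  defines "p \<equiv> c j + c (j + 2) + c (j + 4) + d (j + 1) + d (j + 3) + d (j + 5)"
    and "q \<equiv> c (j + 1) + c (j + 3) + c (j + 5) + d j + d (j + 2) + d (j + 4)"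
  shows "2 \<le> p" "p = 2 \<Longrightarrow> 4 \<le> q"
proof -
  have per: "x (j + 6) = x j" "x (j + 7) = x (j + 1)" "x (j + 8) = x (j + 2)" "x (j + 9) = x (j + 3)"
    "y (j + 6) = y j" "y (j + 7) = y (j + 1)" "y (j + 8) = y (j + 2)" "y (j + 9) = y (j + 3)"
    "x (j + 10) = x (j + 4)" "y (j + 10) = y (j + 4)"
    using dvd_six[OF assms(1)] by simp_all
  note forts = six_forts[OF assms(1,2)]
  have A: "x j \<in> S \<or> x (j + 2) \<in> S \<or> y (j + 1) \<in> S" 
    "x (j + 2) \<in> S \<or> x (j + 4) \<in> S \<or> y (j + 3) \<in> S"
    "x (j + 4) \<in> S \<or> x j \<in> S \<or> y (j + 5) \<in> S"
    using forts(1)[of j] forts(1)[of "j + 2"] forts(1)[of "j + 4"] by (simp_all add: per algebra_simps del: xy_eq)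
  have B: "x j \<in> S \<or> y j \<in> S \<or> y (j + 2) \<in> S \<or> y (j + 4) \<in> S"
    "x (j + 2) \<in> S \<or> y j \<in> S \<or> y (j + 2) \<in> S \<or> y (j + 4) \<in> S"
    "x (j + 4) \<in> S \<or> y j \<in> S \<or> y (j + 2) \<in> S \<or> y (j + 4) \<in> S"
    "x (j + 1) \<in> S \<or> y (j + 1) \<in> S \<or> y (j + 3) \<in> S \<or> y (j + 5) \<in> S"
    "x (j + 3) \<in> S \<or> y (j + 1) \<in> S \<or> y (j + 3) \<in> S \<or> y (j + 5) \<in> S"
    "x (j + 5) \<in> S \<or> y (j + 1) \<in> S \<or> y (j + 3) \<in> S \<or> y (j + 5) \<in> S"
    using forts(2)[of j] forts(2)[of "j + 1"] forts(2)[of "j + 2"] forts(2)[of "j + 3"]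
      forts(2)[of "j + 4"] forts(2)[of "j + 5"] by (auto simp add: per algebra_simps simp del: xy_eq)
  have C: "x (j + 1) \<in> S \<or> x (j + 4) \<in> S \<or> x j \<in> S \<or> y (j + 1) \<in> S \<or> y (j + 3) \<in> S"
    "x (j + 3) \<in> S \<or> x j \<in> S \<or> x (j + 2) \<in> S \<or> y (j + 3) \<in> S \<or> y (j + 5) \<in> S"
    "x (j + 5) \<in> S \<or> x (j + 2) \<in> S \<or> x (j + 4) \<in> S \<or> y (j + 5) \<in> S \<or> y (j + 1) \<in> S"
    using forts(3)[of "j + 1"] forts(3)[of "j + 3"] forts(3)[of "j + 5"]
    by (simp_all add: per algebra_simps del: xy_eq)
  have C': "x (j + 1) \<in> S \<or> x (j + 4) \<in> S \<or> x (j + 2) \<in> S \<or> y (j + 1) \<in> S \<or> y (j + 5) \<in> S"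
    "x (j + 3) \<in> S \<or> x j \<in> S \<or> x (j + 4) \<in> S \<or> y (j + 3) \<in> S \<or> y (j + 1) \<in> S"
    "x (j + 5) \<in> S \<or> x (j + 2) \<in> S \<or> x j \<in> S \<or> y (j + 5) \<in> S \<or> y (j + 3) \<in> S"
    using forts(4)[of "j + 1"] forts(4)[of "j + 3"] forts(4)[of "j + 5"]
    by (simp_all add: per algebra_simps del: xy_eq)
  have D: "x (j + 2) \<in> S \<or> x (j + 3) \<in> S \<or> x (j + 4) \<in> S \<or> y (j + 5) \<in> S \<or> y (j + 1) \<in> S"
    "x (j + 4) \<in> S \<or> x (j + 5) \<in> S \<or> x j \<in> S \<or> y (j + 1) \<in> S \<or> y (j + 3) \<in> S"
    "x j \<in> S \<or> x (j + 1) \<in> S \<or> x (j + 2) \<in> S \<or> y (j + 3) \<in> S \<or> y (j + 5) \<in> S"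
    using forts(5)[of "j + 2"] forts(5)[of "j + 4"] forts(5)[of j]
    by (simp_all add: per algebra_simps del: xy_eq)
  have of_bool: "(of_bool P :: nat) = (if P then 1 else 0)" for P by simp
  show "2 \<le> p"
    unfolding p_def c_def d_def of_bool using A
    by (cases "x j \<in> S"; cases "x (j + 2) \<in> S"; cases "x (j + 4) \<in> S";
        cases "y (j + 1) \<in> S"; cases "y (j + 3) \<in> S"; simp del: xy_eq)
  show "4 \<le> q" if "p = 2"
    using that A B C C' D unfolding p_def q_def c_def d_def of_bool
    by (cases "x j \<in> S"; cases "x (j + 2) \<in> S"; cases "x (j + 4) \<in> S";
        cases "y (j + 1) \<in> S"; cases "y (j + 3) \<in> S"; cases "y (j + 5) \<in> S"; auto simp del: xy_eq)
qed

text \<open>Either both halves contain at least three vertices, or one contains two and the other at least four.\<close>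

lemma leaky_forcing_lower_bound_n6:
  assumes "n = 6" "leaky_forcing_set 1 V E S"
  shows "\<not> card S < 6"
proof -
  define c where "c = (\<lambda>k. of_bool (x k \<in> S) :: nat)"
  define d where "d = (\<lambda>k. of_bool (y k \<in> S) :: nat)"
  have per: "x 6 = x 0" "y 6 = y 0" using dvd_six[OF assms(1)] by simp_all
  have "S \<subseteq> V" using assms(2) by (simp add: leaky_forcing_set_def)
  then have "card S = (\<Sum>v\<in>V \<inter> S. 1)" by (simp add: Int_absorb1)
  also have "\<dots> = (\<Sum>v\<in>V. if v \<in> S then 1 else 0)"
    by (rule sum.inter_restrict) (rule finite_V)
  also have "\<dots> = (c 0 + c 2 + c 4 + d 1 + d 3 + d 5) + (c 1 + c 3 + c 5 + d 0 + d 2 + d 4)"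
    unfolding c_def d_def V_six[OF assms(1), of 0] of_bool_def using dvd_six[OF assms(1)] by simp
  finally have "card S = \<dots>" .
  \<comment> \<open>shifting the index by one exchanges the two halves\<close>
  moreover have "2 \<le> c 0 + c 2 + c 4 + d 1 + d 3 + d 5"
    "c 0 + c 2 + c 4 + d 1 + d 3 + d 5 = 2 \<Longrightarrow> 4 \<le> c 1 + c 3 + c 5 + d 0 + d 2 + d 4"
    using six_halves[OF assms, of 0] by (simp_all add: c_def d_def)
  moreover have "2 \<le> c 1 + c 3 + c 5 + d 2 + d 4 + d 0"
    "c 1 + c 3 + c 5 + d 2 + d 4 + d 0 = 2 \<Longrightarrow> 4 \<le> c 2 + c 4 + c 0 + d 1 + d 3 + d 5"
    using six_halves[OF assms, of 1] by (simp_all add: c_def d_def per del: xy_eq)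
  ultimately show ?thesis by linarith
qed

end

theorem theorem4p8:
  fixes n :: nat
  assumes "n \<ge> 5"
  shows "(n = 5 \<or> n = 8 \<longrightarrow>
            leaky_forcing_number 1 (petersen_verts n) (petersen_edges n 2) = 5) \<and>
         (n = 6 \<or> n = 7 \<or> n \<ge> 9 \<longrightarrow>
            leaky_forcing_number 1 (petersen_verts n) (petersen_edges n 2) = 6)"
proof -
  interpret petersen2 n by unfold_locales (rule assms)
  have "leaky_forcing_number 1 V E = 5" if n: "n = 5 \<or> n = 8"
    using n
  proof
    assume "n = 5"
    show ?thesis
      by (rule leaky_forcing_number_eqI[OF finite_V five_leaky_forcing_5[OF \<open>n = 5\<close>]])
         (rule leaky_forcing_lower_bound_5[OF n])
  next
    assume "n = 8"
    show ?thesis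
      by (rule leaky_forcing_number_eqI[OF finite_V five_leaky_forcing_8[OF \<open>n = 8\<close>]])
         (rule leaky_forcing_lower_bound_5[OF n])
  qed
  moreover have "leaky_forcing_number 1 V E = 6" if "n = 6 \<or> n = 7 \<or> n \<ge> 9"
  proof (rule leaky_forcing_number_eqI[OF finite_V six_leaky_forcing])
    fix T assume T: "leaky_forcing_set 1 V E T"
    show "\<not> card T < 6"
    proof (cases "n = 6")
      case True
      then show ?thesis using T by (rule leaky_forcing_lower_bound_n6)
    next
      case False
      with that have "7 \<le> n" "n \<noteq> 8" by auto
      then show ?thesis using T by (rule leaky_forcing_lower_bound_6)
    qed
  qed
  ultimately show ?thesis by blast
qed

end
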